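(* Let $k_n=k_n(x)$ be a (smooth) covariant vector field on $M$ and let $$N^k_n=-l^k\,\frac{\partial F}{\partial x^n}-F\,m^k\left(\frac{\partial\theta}{\partial x^n}-k_n\right),\qquad D^k{}_{nm}=-\frac{\partial N^k_n}{\partial y^m},\qquad d_n=\frac{\partial}{\partial x^n}+N^k_n\frac{\partial}{\partial y^k}.$$ Then the tensors $$M^n{}_{ij}=d_iN^n_j-d_jN^n_i,\qquad E_k{}^n{}_{ij}=d_iD^n{}_{jk}-d_jD^n{}_{ik}+D^m{}_{jk}D^n{}_{im}-D^m{}_{ik}D^n{}_{jm}$$ are given by $$M^n{}_{ij}=F\,m^nM_{ij},\qquad E_k{}^n{}_{ij}=\bigl(-l_km^n+l^nm_k+I\,m_km^n\bigr)M_{ij},$$ where $$M_{ij}=\frac{\partial k_j}{\partial x^i}-\frac{\partial k_i}{\partial x^j}.$$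
   Context: $M$ is a 2-dimensional $C^\infty$ manifold; the consideration is local, in coordinates $x^1,x^2$ with induced fibre coordinates $y^1,y^2$ (no orientation-reversing changes). $F=F(x,y)$ is a Finsler metric function (positive, positively homogeneous of degree 1 in $y$, sufficiently smooth for $y\ne0$, with positive definite metric tensor), considered on an open conic region of nonzero tangent vectors. Notation: $l^k=y^k/F$, $y_k=F\,\partial F/\partial y^k$, $l_k=\partial F/\partial y^k=y_k/F$, $g_{ij}=\partial y_i/\partial y^j$, $g^{ij}$ its inverse. With $\gamma_{11}=\gamma_{22}=0$, $\gamma_{12}=-\gamma_{21}=1$, put $\epsilon_{ik}=\sqrt{\det(g_{mn})}\,\gamma_{ik}$, $m_i=-\epsilon_{ik}l^k$, $m^i=g^{ij}m_j$; then $g_{ij}=l_il_j+m_im_j$. The Cartan tensor is $C_{ijk}=\frac12\partial g_{ij}/\partial y^k$, $A_{ijk}=FC_{ijk}$, and the main scalar $I=I(x,y)$ is defined by $A_{ijk}=I\,m_im_jm_k$. The angle function $\theta=\theta(x,y)$ is a (smooth) function, positively homogeneous of degree zero in $y$, satisfying $F\,\partial\theta/\partial y^n=m_n$ on the region considered. Repeated indices (running over $1,2$) are summed. *)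

theory Defs
  imports "HOL-Analysis.Analysis"
begin

text \<open>
  Everything is expressed in one arbitrary chart of the surface. A point of the tangent bundle is
  a pair \<open>(x, y)\<close> of coordinates and fibre coordinates, and the index type \<open>2\<close> has the
  elements \<open>1\<close> and \<open>2\<close>. Upper indices are passed before lower ones.
\<close>

type_synonym tpoint = "(real^2) \<times> (real^2)"

definition pd :: "'a::euclidean_space \<Rightarrow> ('a \<Rightarrow> real) \<Rightarrow> 'a \<Rightarrow> real" where
  "pd b f p = deriv (\<lambda>t. f (p + t *\<^sub>R b)) 0"

text \<open>Continuous differentiability of order \<open>n\<close>; meant for open \<open>S\<close>.\<close>

fun C_on :: "nat \<Rightarrow> ('a::euclidean_space \<Rightarrow> real) \<Rightarrow> 'a set \<Rightarrow> bool" where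
  "C_on 0 f S \<longleftrightarrow> continuous_on S f"
| "C_on (Suc n) f S \<longleftrightarrow>
     (\<forall>p\<in>S. f differentiable (at p)) \<and> (\<forall>b\<in>Basis. C_on n (pd b f) S)"

definition dx :: "2 \<Rightarrow> (tpoint \<Rightarrow> real) \<Rightarrow> tpoint \<Rightarrow> real" where
  "dx i f = pd (axis i 1, 0) f"

definition dy :: "2 \<Rightarrow> (tpoint \<Rightarrow> real) \<Rightarrow> tpoint \<Rightarrow> real" where
  "dy i f = pd (0, axis i 1) f"

definition l_up :: "(tpoint \<Rightarrow> real) \<Rightarrow> 2 \<Rightarrow> tpoint \<Rightarrow> real" where
  "l_up F k p = snd p $ k / F p"

definition y_low :: "(tpoint \<Rightarrow> real) \<Rightarrow> 2 \<Rightarrow> tpoint \<Rightarrow> real" where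
  "y_low F k p = F p * dy k F p"

definition l_low :: "(tpoint \<Rightarrow> real) \<Rightarrow> 2 \<Rightarrow> tpoint \<Rightarrow> real" where
  "l_low F k p = dy k F p"

definition g_low :: "(tpoint \<Rightarrow> real) \<Rightarrow> 2 \<Rightarrow> 2 \<Rightarrow> tpoint \<Rightarrow> real" where
  "g_low F i j p = dy j (y_low F i) p"

definition g_mat :: "(tpoint \<Rightarrow> real) \<Rightarrow> tpoint \<Rightarrow> real^2^2" where
  "g_mat F p = (\<chi> i j. g_low F i j p)"

definition g_up :: "(tpoint \<Rightarrow> real) \<Rightarrow> 2 \<Rightarrow> 2 \<Rightarrow> tpoint \<Rightarrow> real" where
  "g_up F i j p = matrix_inv (g_mat F p) $ i $ j"

definition perm_symbol :: "2 \<Rightarrow> 2 \<Rightarrow> real" where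
  "perm_symbol i j = (if i = 1 \<and> j = 2 then 1 else if i = 2 \<and> j = 1 then - 1 else 0)"

definition eps_low :: "(tpoint \<Rightarrow> real) \<Rightarrow> 2 \<Rightarrow> 2 \<Rightarrow> tpoint \<Rightarrow> real" where
  "eps_low F i k p = sqrt (det (g_mat F p)) * perm_symbol i k"

definition m_low :: "(tpoint \<Rightarrow> real) \<Rightarrow> 2 \<Rightarrow> tpoint \<Rightarrow> real" where
  "m_low F i p = - (\<Sum>k\<in>UNIV. eps_low F i k p * l_up F k p)"

definition m_up :: "(tpoint \<Rightarrow> real) \<Rightarrow> 2 \<Rightarrow> tpoint \<Rightarrow> real" where
  "m_up F i p = (\<Sum>j\<in>UNIV. g_up F i j p * m_low F j p)"

definition cartan :: "(tpoint \<Rightarrow> real) \<Rightarrow> 2 \<Rightarrow> 2 \<Rightarrow> 2 \<Rightarrow> tpoint \<Rightarrow> real" where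
  "cartan F i j k p = (1/2) * dy k (g_low F i j) p"

definition A_low :: "(tpoint \<Rightarrow> real) \<Rightarrow> 2 \<Rightarrow> 2 \<Rightarrow> 2 \<Rightarrow> tpoint \<Rightarrow> real" where
  "A_low F i j k p = F p * cartan F i j k p"

definition main_scalar :: "(tpoint \<Rightarrow> real) \<Rightarrow> tpoint \<Rightarrow> real" where
  "main_scalar F p =
     (THE I. \<forall>i j k. A_low F i j k p = I * m_low F i p * m_low F j p * m_low F k p)"

text \<open>
  \<open>U\<close> is the coordinate domain and \<open>W\<close> the open conic region of nonzero tangent vectors
  over it. Four continuous derivatives of \<open>F\<close> (three of the angle function, one of the
  covector field) are what makes all derivatives occurring in the two curvature tensors below
  exist and be continuous.
\<close>

definition conic_region :: "(real^2) set \<Rightarrow> tpoint set \<Rightarrow> bool" where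
  "conic_region U W \<longleftrightarrow> open U \<and> open W \<and>
     (\<forall>(x, y)\<in>W. x \<in> U \<and> y \<noteq> 0 \<and> (\<forall>t>0. (x, t *\<^sub>R y) \<in> W))"

definition finsler_metric_on :: "tpoint set \<Rightarrow> (tpoint \<Rightarrow> real) \<Rightarrow> bool" where
  "finsler_metric_on W F \<longleftrightarrow>
     C_on 4 F W \<and>
     (\<forall>p\<in>W. F p > 0) \<and>
     (\<forall>(x, y)\<in>W. \<forall>t>0. F (x, t *\<^sub>R y) = t * F (x, y)) \<and>
     (\<forall>p\<in>W. \<forall>v. v \<noteq> 0 \<longrightarrow> v \<bullet> (g_mat F p *v v) > 0)"

definition angle_function_on ::
    "tpoint set \<Rightarrow> (tpoint \<Rightarrow> real) \<Rightarrow> (tpoint \<Rightarrow> real) \<Rightarrow> bool" where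
  "angle_function_on W F \<theta> \<longleftrightarrow>
     C_on 3 \<theta> W \<and>
     (\<forall>(x, y)\<in>W. \<forall>t>0. \<theta> (x, t *\<^sub>R y) = \<theta> (x, y)) \<and>
     (\<forall>p\<in>W. \<forall>n. F p * dy n \<theta> p = m_low F n p)"

definition covector_field_on :: "(real^2) set \<Rightarrow> (real^2 \<Rightarrow> real^2) \<Rightarrow> bool" where
  "covector_field_on U \<kappa> \<longleftrightarrow> (\<forall>n. C_on 1 (\<lambda>x. \<kappa> x $ n) U)"

definition N_coeff ::
    "(tpoint \<Rightarrow> real) \<Rightarrow> (tpoint \<Rightarrow> real) \<Rightarrow> (real^2 \<Rightarrow> real^2) \<Rightarrow> 2 \<Rightarrow> 2 \<Rightarrow> tpoint \<Rightarrow> real" where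
  "N_coeff F \<theta> \<kappa> k n p =
     - l_up F k p * dx n F p - F p * m_up F k p * (dx n \<theta> p - \<kappa> (fst p) $ n)"

definition D_coeff ::
    "(tpoint \<Rightarrow> real) \<Rightarrow> (tpoint \<Rightarrow> real) \<Rightarrow> (real^2 \<Rightarrow> real^2) \<Rightarrow> 2 \<Rightarrow> 2 \<Rightarrow> 2 \<Rightarrow> tpoint \<Rightarrow> real" where
  "D_coeff F \<theta> \<kappa> k n m p = - dy m (N_coeff F \<theta> \<kappa> k n) p"

definition d_op ::
    "(tpoint \<Rightarrow> real) \<Rightarrow> (tpoint \<Rightarrow> real) \<Rightarrow> (real^2 \<Rightarrow> real^2) \<Rightarrow> 2 \<Rightarrow> (tpoint \<Rightarrow> real) \<Rightarrow> tpoint \<Rightarrow> real" where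
  "d_op F \<theta> \<kappa> n f p = dx n f p + (\<Sum>k\<in>UNIV. N_coeff F \<theta> \<kappa> k n p * dy k f p)"

definition M_tensor ::
    "(tpoint \<Rightarrow> real) \<Rightarrow> (tpoint \<Rightarrow> real) \<Rightarrow> (real^2 \<Rightarrow> real^2) \<Rightarrow> 2 \<Rightarrow> 2 \<Rightarrow> 2 \<Rightarrow> tpoint \<Rightarrow> real" where
  "M_tensor F \<theta> \<kappa> n i j p =
     d_op F \<theta> \<kappa> i (N_coeff F \<theta> \<kappa> n j) p - d_op F \<theta> \<kappa> j (N_coeff F \<theta> \<kappa> n i) p"

text \<open>\<open>E_tensor F \<theta> \<kappa> k n i j\<close> is $E_k{}^n{}_{ij}$: here the first index \<open>k\<close> is
  lower and the second index \<open>n\<close> upper.\<close>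

definition E_tensor ::
    "(tpoint \<Rightarrow> real) \<Rightarrow> (tpoint \<Rightarrow> real) \<Rightarrow> (real^2 \<Rightarrow> real^2) \<Rightarrow> 2 \<Rightarrow> 2 \<Rightarrow> 2 \<Rightarrow> 2 \<Rightarrow> tpoint \<Rightarrow> real" where
  "E_tensor F \<theta> \<kappa> k n i j p =
     d_op F \<theta> \<kappa> i (D_coeff F \<theta> \<kappa> n j k) p - d_op F \<theta> \<kappa> j (D_coeff F \<theta> \<kappa> n i k) p
     + (\<Sum>m\<in>UNIV. D_coeff F \<theta> \<kappa> m j k p * D_coeff F \<theta> \<kappa> n i m p)
     - (\<Sum>m\<in>UNIV. D_coeff F \<theta> \<kappa> m i k p * D_coeff F \<theta> \<kappa> n j m p)"

definition curl :: "(real^2 \<Rightarrow> real^2) \<Rightarrow> 2 \<Rightarrow> 2 \<Rightarrow> real^2 \<Rightarrow> real" where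
  "curl \<kappa> i j x = pd (axis i 1) (\<lambda>x. \<kappa> x $ j) x - pd (axis j 1) (\<lambda>x. \<kappa> x $ i) x"

end

theory Submission
  imports Defs
begin

text \<open>
  On each tangent plane the pair $(F, \theta)$ serves as a system of polar coordinates, and the
  coefficients $N^k_n$ are chosen so that the horizontal fields $d_n$ act on these two functions in
  the simplest way: \<open>d_F\<close> and \<open>d_\<theta>\<close> say that $d_n F = 0$ and $d_n \theta = k_n$. This is a
  computation with the frame $l, m$ and its dual (\<open>l_norm\<close>, \<open>frame_dual\<close>).

  The commutator $[d_i, d_j]$ is the vertical field $M^n{}_{ij}\,\partial/\partial y^n$
  (\<open>commutator_d\<close>). Applying it to $F$ gives $M^n{}_{ij} l_n = 0$; applying it to $\theta$ gives
  $M^n{}_{ij} m_n / F = \partial_i k_j - \partial_j k_i$, because $k$ depends on the base point only.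
  Since $l^n l_k + m^n m_k = \delta^n_k$ (\<open>frame_complete\<close>), the two contractions determine
  $M^n{}_{ij} = F m^n M_{ij}$; this is \<open>M_tensor_eq\<close>.

  The second tensor is a fibre derivative of the first: $D = -\partial N/\partial y$, so
  differentiating the definition of $M^n{}_{ij}$ in the direction $y^k$ and exchanging the order of
  the derivatives yields $E_k{}^n{}_{ij} = -\partial M^n{}_{ij}/\partial y^k$
  (\<open>E_tensor_eq_dy_M\<close>). As $M_{ij}$ is constant along the fibres, only
  $\partial (F m^n)/\partial y^k$ is left (\<open>dy_angular\<close>). In dimension two
  $F m^1 = -y_2/\sqrt{\det g}$ and $F m^2 = y_1/\sqrt{\det g}$, so this derivative
  needs $\partial y_i/\partial y^k = g_{ik} = l_i l_k + m_i m_k$ and the logarithmic derivative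
  $\partial_k \ln \det g = 2 I m_k / F$ (\<open>dy_gdet\<close>), which is where the main scalar enters.

  The analytic side consists of the symmetry of mixed derivatives and of the closure of
  continuous differentiability under arithmetic operations. The one delicate point is that $k$ is only
  once differentiable, so that $N$ has no second derivatives in general; the mixed derivatives with
  one differentiation along the fibre nevertheless exist and commute (\<open>has_pd_pd_affine\<close>).
\<close>

section \<open>Directional derivatives\<close>

text \<open>
  The relational form of \<^const>\<open>pd\<close>, which also carries existence. It asks for nothing off the line
  through \<open>p\<close>: derivatives of \<open>\<kappa>\<close> are merely continuous on the base, yet constant along the
  fibres, and so are differentiable in the fibre directions only.
\<close>

definition has_pd :: "'a::euclidean_space \<Rightarrow> ('a \<Rightarrow> real) \<Rightarrow> real \<Rightarrow> 'a \<Rightarrow> bool" where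
  "has_pd b f D p \<longleftrightarrow> ((\<lambda>t. f (p + t *\<^sub>R b)) has_real_derivative D) (at 0)"

lemma has_pd_imp_pd: "has_pd b f D p \<Longrightarrow> pd b f p = D"
  unfolding has_pd_def pd_def by (rule DERIV_imp_deriv)

lemma has_pd_const: "has_pd b (\<lambda>_. c) 0 p"
  unfolding has_pd_def by simp

lemma has_pd_add: "has_pd b f D p \<Longrightarrow> has_pd b g E p \<Longrightarrow> has_pd b (\<lambda>p. f p + g p) (D + E) p"
  unfolding has_pd_def by (rule DERIV_add)

lemma has_pd_minus: "has_pd b f D p \<Longrightarrow> has_pd b (\<lambda>p. - f p) (- D) p"
  unfolding has_pd_def by (rule DERIV_minus)

lemma has_pd_diff: "has_pd b f D p \<Longrightarrow> has_pd b g E p \<Longrightarrow> has_pd b (\<lambda>p. f p - g p) (D - E) p"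
  unfolding has_pd_def by (rule DERIV_diff)

lemma has_pd_mult:
  "has_pd b f D p \<Longrightarrow> has_pd b g E p \<Longrightarrow> has_pd b (\<lambda>p. f p * g p) (D * g p + f p * E) p"
  unfolding has_pd_def by (auto intro!: derivative_eq_intros)

lemma has_pd_compose:
  "has_pd b f D p \<Longrightarrow> (h has_real_derivative E) (at (f p)) \<Longrightarrow> has_pd b (\<lambda>p. h (f p)) (E * D) p"
  unfolding has_pd_def using DERIV_chain2[of h E "\<lambda>t. f (p + t *\<^sub>R b)" 0 D UNIV] by simp

lemma has_pd_along_line:
  assumes "has_pd b f D (p + s *\<^sub>R b)"
  shows "((\<lambda>t. f (p + t *\<^sub>R b)) has_real_derivative D) (at s)"
proof -
  have "((\<lambda>t. f (p + (s + t) *\<^sub>R b)) has_real_derivative D) (at 0)"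
    using assms by (simp add: has_pd_def scaleR_add_left add.assoc)
  then show ?thesis
    using DERIV_shift[of "\<lambda>t. f (p + t *\<^sub>R b)" D 0 s] by (simp add: add.commute)
qed

lemma eventually_line_in_open:
  fixes p b :: "'a::euclidean_space"
  assumes "open S" "p \<in> S"
  shows "\<forall>\<^sub>F t in nhds 0. p + t *\<^sub>R b \<in> S"
proof -
  have "((\<lambda>t. p + t *\<^sub>R b) \<longlongrightarrow> p + 0 *\<^sub>R b) (nhds 0)"
    by (intro tendsto_intros) (simp add: filterlim_ident)
  then show ?thesis
    using assms topological_tendstoD by fastforce
qed

lemma has_pd_cong:
  assumes "open S" "p \<in> S" "\<And>q. q \<in> S \<Longrightarrow> f q = g q" "has_pd b f D p"
  shows "has_pd b g D p"
proof -
  have "\<forall>\<^sub>F t in nhds 0. g (p + t *\<^sub>R b) = f (p + t *\<^sub>R b)"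
    using eventually_line_in_open[OF assms(1,2), of b] by eventually_elim (simp add: assms(3))
  then show ?thesis
    using assms(4) DERIV_cong_ev[of 0 0 "\<lambda>t. g (p + t *\<^sub>R b)" "\<lambda>t. f (p + t *\<^sub>R b)" D D]
    unfolding has_pd_def by blast
qed

lemma pd_cong:
  assumes "open S" "p \<in> S" "\<And>q. q \<in> S \<Longrightarrow> f q = g q"
  shows "pd b f p = pd b g p"
proof -
  have "\<forall>\<^sub>F t in nhds 0. f (p + t *\<^sub>R b) = g (p + t *\<^sub>R b)"
    using eventually_line_in_open[OF assms(1,2), of b] by eventually_elim (simp add: assms(3))
  then show ?thesis unfolding pd_def by (rule deriv_cong_ev) simp
qed

lemma has_derivative_imp_has_pd:
  assumes "(f has_derivative f') (at p)"
  shows "has_pd b f (f' b) p"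
proof -
  have "((\<lambda>t. f (p + t *\<^sub>R b)) has_derivative (\<lambda>t. f' (t *\<^sub>R b))) (at 0)"
    by (rule has_derivative_compose[of "\<lambda>t. p + t *\<^sub>R b" "\<lambda>t. t *\<^sub>R b" 0 UNIV f f'])
       (auto intro!: derivative_eq_intros assms)
  moreover have "(\<lambda>t. f' (t *\<^sub>R b)) = (*) (f' b)"
    using linear_cmul[OF has_derivative_linear[OF assms]] by (auto simp: mult.commute)
  ultimately show ?thesis
    unfolding has_pd_def has_field_derivative_def by simp
qed

lemma differentiable_imp_has_pd:
  "f differentiable (at p) \<Longrightarrow> has_pd b f (pd b f p) p"
  using has_derivative_imp_has_pd has_pd_imp_pd unfolding differentiable_def by metis

lemma pd_linear_combination:
  assumes "f differentiable (at p)"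
  shows "pd (s *\<^sub>R a + t *\<^sub>R b) f p = s * pd a f p + t * pd b f p"
proof -
  obtain f' where f': "(f has_derivative f') (at p)"
    using assms unfolding differentiable_def by blast
  have "pd c f p = f' c" for c
    by (rule has_pd_imp_pd[OF has_derivative_imp_has_pd[OF f']])
  moreover have "linear f'" by (rule has_derivative_linear[OF f'])
  ultimately show ?thesis by (simp add: linear_add linear_cmul)
qed

section \<open>Symmetry of mixed derivatives\<close>

text \<open>
  The first half of the classical proof of Schwarz's theorem: the mean value theorem, applied first along
  \<open>a\<close> and then along \<open>b\<close>, turns the second difference over a parallelogram into a mixed derivative
  at an interior point. The second difference is symmetric in \<open>a\<close> and \<open>b\<close>.
\<close>

lemma second_difference_mean_value:
  fixes p a b :: "'a::euclidean_space"
  assumes "0 < h" and sub: "\<And>s t. 0 \<le> s \<Longrightarrow> s \<le> h \<Longrightarrow> 0 \<le> t \<Longrightarrow> t \<le> h \<Longrightarrow> p + s *\<^sub>R a + t *\<^sub>R b \<in> S"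
    and fa: "\<And>q. q \<in> S \<Longrightarrow> has_pd a f (fa q) q"
    and fab: "\<And>q. q \<in> S \<Longrightarrow> has_pd b fa (fab q) q"
  obtains s t where "0 < s" "s < h" "0 < t" "t < h"
    "f (p + h *\<^sub>R a + h *\<^sub>R b) - f (p + h *\<^sub>R a) - f (p + h *\<^sub>R b) + f p
      = h * h * fab (p + s *\<^sub>R a + t *\<^sub>R b)"
proof -
  let ?\<phi> = "\<lambda>s. f ((p + h *\<^sub>R b) + s *\<^sub>R a) - f (p + s *\<^sub>R a)"
  have "(?\<phi> has_real_derivative fa ((p + h *\<^sub>R b) + s *\<^sub>R a) - fa (p + s *\<^sub>R a)) (at s)"
    if "0 \<le> s" "s \<le> h" for s
    using sub[of s h] sub[of s 0] that \<open>0 < h\<close>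
    by (intro DERIV_diff has_pd_along_line fa) (auto simp: add_ac)
  from MVT2[OF \<open>0 < h\<close> this] obtain s where s: "0 < s" "s < h"
    "?\<phi> h - ?\<phi> 0 = (h - 0) * (fa ((p + h *\<^sub>R b) + s *\<^sub>R a) - fa (p + s *\<^sub>R a))" by blast
  have "((\<lambda>t. fa ((p + s *\<^sub>R a) + t *\<^sub>R b)) has_real_derivative fab ((p + s *\<^sub>R a) + t *\<^sub>R b)) (at t)"
    if "0 \<le> t" "t \<le> h" for t
    using sub[of s t] that s by (intro has_pd_along_line fab) auto
  from MVT2[OF \<open>0 < h\<close> this] obtain t where t: "0 < t" "t < h"
    "fa ((p + s *\<^sub>R a) + h *\<^sub>R b) - fa ((p + s *\<^sub>R a) + 0 *\<^sub>R b) = (h - 0) * fab ((p + s *\<^sub>R a) + t *\<^sub>R b)" by blast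
  have "f (p + h *\<^sub>R a + h *\<^sub>R b) - f (p + h *\<^sub>R a) - f (p + h *\<^sub>R b) + f p
      = h * h * fab (p + s *\<^sub>R a + t *\<^sub>R b)"
    using s(3) t(3) by (simp add: add_ac)
  with s t that show ?thesis by blast
qed

text \<open>
  Both mixed derivatives, each at some point of an arbitrarily small parallelogram at \<open>p\<close>, equal the
  same second difference quotient; by continuity they agree at \<open>p\<close>.
\<close>

lemma mixed_derivatives_eq:
  fixes p a b :: "'a::euclidean_space"
  assumes "open S" "p \<in> S"
    and fa: "\<And>q. q \<in> S \<Longrightarrow> has_pd a f (fa q) q"
    and fb: "\<And>q. q \<in> S \<Longrightarrow> has_pd b f (fb q) q"
    and fab: "\<And>q. q \<in> S \<Longrightarrow> has_pd b fa (fab q) q"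
    and fba: "\<And>q. q \<in> S \<Longrightarrow> has_pd a fb (fba q) q"
    and cab: "continuous_on S fab" and cba: "continuous_on S fba"
  shows "fab p = fba p"
proof (rule ccontr)
  assume "fab p \<noteq> fba p"
  define e where "e = \<bar>fab p - fba p\<bar> / 2"
  have "e > 0" using \<open>fab p \<noteq> fba p\<close> by (simp add: e_def)
  have "isCont fab p" "isCont fba p"
    using cab cba assms(1,2) continuous_on_eq_continuous_at by blast+
  then obtain r1 r2 where r12: "r1 > 0" "r2 > 0"
    and c1: "\<And>q. dist q p < r1 \<Longrightarrow> \<bar>fab q - fab p\<bar> < e"
    and c2: "\<And>q. dist q p < r2 \<Longrightarrow> \<bar>fba q - fba p\<bar> < e"
    using \<open>e > 0\<close> unfolding continuous_at_eps_delta dist_real_def by metis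
  obtain r3 where r3: "r3 > 0" "\<And>q. dist q p < r3 \<Longrightarrow> q \<in> S"
    using assms(1,2) unfolding open_dist by blast
  define r where "r = min r1 (min r2 r3)"
  \<comment> \<open>The summand 1 keeps the denominator positive when both directions vanish.\<close>
  define h where "h = r / (norm a + norm b + 1)"
  have n0: "norm a + norm b + 1 > 0" by (simp add: add_nonneg_pos)
  have "r > 0" using r12 r3 by (simp add: r_def)
  then have "h > 0" using n0 by (simp add: h_def)
  have near: "dist (p + s *\<^sub>R a + t *\<^sub>R b) p < r" if "0 \<le> s" "s \<le> h" "0 \<le> t" "t \<le> h" for s t
  proof -
    have "dist (p + s *\<^sub>R a + t *\<^sub>R b) p = norm (s *\<^sub>R a + t *\<^sub>R b)"
      by (simp add: dist_norm add.assoc)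
    also have "\<dots> \<le> s * norm a + t * norm b"
      using norm_triangle_ineq[of "s *\<^sub>R a" "t *\<^sub>R b"] that by simp
    also have "\<dots> \<le> h * norm a + h * norm b"
      by (intro add_mono mult_right_mono that norm_ge_zero)
    also have "\<dots> < h * (norm a + norm b + 1)" using \<open>h > 0\<close> by (simp add: algebra_simps)
    also have "\<dots> = r" using n0 by (simp add: h_def)
    finally show ?thesis .
  qed
  have inS: "p + s *\<^sub>R a + t *\<^sub>R b \<in> S" if "0 \<le> s" "s \<le> h" "0 \<le> t" "t \<le> h" for s t
    using near[OF that] r3(2) by (simp add: r_def)
  obtain s t where st: "0 < s" "s < h" "0 < t" "t < h"
    "f (p + h *\<^sub>R a + h *\<^sub>R b) - f (p + h *\<^sub>R a) - f (p + h *\<^sub>R b) + f p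
      = h * h * fab (p + s *\<^sub>R a + t *\<^sub>R b)"
    using second_difference_mean_value[OF \<open>h > 0\<close> inS fa fab] by blast
  have inS': "p + t *\<^sub>R b + s *\<^sub>R a \<in> S" if "0 \<le> t" "t \<le> h" "0 \<le> s" "s \<le> h" for s t
    using inS[OF that(3,4,1,2)] by (simp add: add_ac)
  obtain t' s' where st': "0 < t'" "t' < h" "0 < s'" "s' < h"
    "f (p + h *\<^sub>R b + h *\<^sub>R a) - f (p + h *\<^sub>R b) - f (p + h *\<^sub>R a) + f p
      = h * h * fba (p + t' *\<^sub>R b + s' *\<^sub>R a)"
    using second_difference_mean_value[OF \<open>h > 0\<close> inS' fb fba] by blast
  have "h * h * fab (p + s *\<^sub>R a + t *\<^sub>R b) = h * h * fba (p + s' *\<^sub>R a + t' *\<^sub>R b)"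
    using st(5) st'(5) by (simp only: add_ac diff_conv_add_uminus)
  then have eq: "fab (p + s *\<^sub>R a + t *\<^sub>R b) = fba (p + s' *\<^sub>R a + t' *\<^sub>R b)"
    using \<open>h > 0\<close> by simp
  have "\<bar>fab (p + s *\<^sub>R a + t *\<^sub>R b) - fab p\<bar> < e" "\<bar>fba (p + s' *\<^sub>R a + t' *\<^sub>R b) - fba p\<bar> < e"
    using near[of s t] near[of s' t'] st st' c1 c2 by (auto simp: r_def)
  then have "\<bar>fab p - fba p\<bar> < e + e" using eq by linarith
  then show False by (simp add: e_def)
qed

section \<open>Functions with continuous derivatives\<close>

lemma C_on_imp_has_pd: "C_on (Suc n) f S \<Longrightarrow> p \<in> S \<Longrightarrow> has_pd b f (pd b f p) p"
  by (simp add: differentiable_imp_has_pd)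

lemma C1_has_pd: "C_on 1 f S \<Longrightarrow> p \<in> S \<Longrightarrow> has_pd b f (pd b f p) p"
  by (rule C_on_imp_has_pd[of 0]) simp_all

lemma C_on_pd: "C_on (Suc n) f S \<Longrightarrow> b \<in> Basis \<Longrightarrow> C_on n (pd b f) S"
  by simp

lemma C_on_Suc_imp: "C_on (Suc n) f S \<Longrightarrow> C_on n f S"
proof (induction n arbitrary: f)
  case 0
  then show ?case
    by (simp add: differentiable_imp_continuous_within continuous_at_imp_continuous_on)
next
  case (Suc n)
  then show ?case by simp
qed

lemma C_on_le: "C_on n f S \<Longrightarrow> m \<le> n \<Longrightarrow> C_on m f S"
  by (induction n) (auto simp: le_Suc_eq dest: C_on_Suc_imp simp del: C_on.simps(2))

lemma C_on_cong:
  assumes "open S" "\<And>q. q \<in> S \<Longrightarrow> f q = g q" "C_on n f S"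
  shows "C_on n g S"
  using assms(2,3)
proof (induction n arbitrary: f g)
  case 0
  then show ?case using continuous_on_cong[of S S f g] by simp
next
  case (Suc n)
  have "g differentiable (at p)" if p: "p \<in> S" for p
  proof -
    obtain f' where "(f has_derivative f') (at p)"
      using Suc.prems(2) p unfolding C_on.simps differentiable_def by blast
    then have "(g has_derivative f') (at p)"
      by (rule has_derivative_transform_within_open[OF _ assms(1) p Suc.prems(1)])
    then show ?thesis unfolding differentiable_def by blast
  qed
  moreover have "C_on n (pd b g) S" if "b \<in> Basis" for b
  proof (rule Suc.IH)
    show "pd b f q = pd b g q" if "q \<in> S" for q
      by (rule pd_cong[OF assms(1) that Suc.prems(1)])
    show "C_on n (pd b f) S" using Suc.prems(2) \<open>b \<in> Basis\<close> by simp
  qed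
  ultimately show ?case by simp
qed

text \<open>
  Lets the closure lemmas below name the derivative \<open>f'\<close> by the usual differentiation rule, so that its
  regularity is an instance of the induction hypothesis.
\<close>

lemma C_on_SucI:
  assumes "open S" "\<And>p. p \<in> S \<Longrightarrow> f differentiable (at p)"
    and "\<And>b. b \<in> Basis \<Longrightarrow> C_on n (f' b) S"
    and "\<And>b p. b \<in> Basis \<Longrightarrow> p \<in> S \<Longrightarrow> has_pd b f (f' b p) p"
  shows "C_on (Suc n) f S"
proof -
  have "C_on n (pd b f) S" if "b \<in> Basis" for b
    by (rule C_on_cong[OF assms(1) _ assms(3)[OF that]]) (metis has_pd_imp_pd assms(4) that)
  with assms(2) show ?thesis by simp
qed

lemma C_on_const: "open S \<Longrightarrow> C_on n (\<lambda>_. c) S"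
proof (induction n arbitrary: c)
  case (Suc n)
  then show ?case by (intro C_on_SucI[where f' = "\<lambda>_ _. 0"]) (auto simp: has_pd_const)
qed simp

lemma C_on_bounded_linear:
  assumes "open S" "bounded_linear f"
  shows "C_on n f S"
proof (cases n)
  case 0
  then show ?thesis using assms(2) linear_continuous_on by simp
next
  case (Suc m)
  have "(f has_derivative f) (at p)" for p
    using assms(2) by (rule bounded_linear_imp_has_derivative)
  then show ?thesis unfolding Suc
    using assms(1)
    by (intro C_on_SucI[where f' = "\<lambda>b _. f b"])
       (auto simp: differentiable_def C_on_const intro: has_derivative_imp_has_pd)
qed

lemma C_on_minus: "open S \<Longrightarrow> C_on n f S \<Longrightarrow> C_on n (\<lambda>p. - f p) S"
proof (induction n arbitrary: f)
  case 0
  then show ?case by (simp add: continuous_on_minus)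
next
  case (Suc n)
  show ?case
    by (rule C_on_SucI[where f' = "\<lambda>b p. - pd b f p"])
       (use Suc in \<open>auto intro: has_pd_minus differentiable_imp_has_pd\<close>)
qed

lemma C_on_add: "open S \<Longrightarrow> C_on n f S \<Longrightarrow> C_on n g S \<Longrightarrow> C_on n (\<lambda>p. f p + g p) S"
proof (induction n arbitrary: f g)
  case 0
  then show ?case by (simp add: continuous_on_add)
next
  case (Suc n)
  show ?case
    by (rule C_on_SucI[where f' = "\<lambda>b p. pd b f p + pd b g p"])
       (use Suc in \<open>auto intro!: has_pd_add differentiable_imp_has_pd\<close>)
qed

lemma C_on_diff: "open S \<Longrightarrow> C_on n f S \<Longrightarrow> C_on n g S \<Longrightarrow> C_on n (\<lambda>p. f p - g p) S"
  using C_on_add[of S n f "\<lambda>p. - g p"] C_on_minus[of S n g] by simp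

lemma C_on_mult: "open S \<Longrightarrow> C_on n f S \<Longrightarrow> C_on n g S \<Longrightarrow> C_on n (\<lambda>p. f p * g p) S"
proof (induction n arbitrary: f g)
  case 0
  then show ?case by (simp add: continuous_on_mult)
next
  case (Suc n)
  have low: "C_on n f S" "C_on n g S" using Suc.prems C_on_Suc_imp by blast+
  show ?case
    by (rule C_on_SucI[where f' = "\<lambda>b p. pd b f p * g p + f p * pd b g p"])
       (use Suc low in \<open>auto intro!: C_on_add has_pd_mult differentiable_imp_has_pd\<close>)
qed

lemma C_on_inverse:
  assumes "open S" "\<And>p. p \<in> S \<Longrightarrow> f p \<noteq> 0"
  shows "C_on n f S \<Longrightarrow> C_on n (\<lambda>p. inverse (f p)) S"
proof (induction n)
  case 0
  then show ?case using assms by (auto intro: continuous_on_inverse)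
next
  case (Suc n)
  have "C_on n f S" using Suc.prems C_on_Suc_imp by blast
  then have inv: "C_on n (\<lambda>p. inverse (f p)) S" by (rule Suc.IH)
  show ?case
  proof (rule C_on_SucI[where f' = "\<lambda>b p. - (inverse (f p) * inverse (f p)) * pd b f p"])
    fix p assume "p \<in> S"
    then show "(\<lambda>p. inverse (f p)) differentiable (at p)"
      using Suc.prems assms(2) by (auto intro: differentiable_inverse)
    fix b
    have "(inverse has_real_derivative - (inverse (f p) * inverse (f p))) (at (f p))"
      using DERIV_inverse[of "f p" UNIV] assms(2)[OF \<open>p \<in> S\<close>] by (simp add: power2_eq_square)
    then show "has_pd b (\<lambda>p. inverse (f p)) (- (inverse (f p) * inverse (f p)) * pd b f p) p"
      by (rule has_pd_compose[OF C_on_imp_has_pd[OF Suc.prems \<open>p \<in> S\<close>]])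
  qed (use Suc.prems inv assms(1) in \<open>auto intro!: C_on_mult C_on_minus\<close>)
qed

lemma C_on_divide:
  assumes "open S" "\<And>p. p \<in> S \<Longrightarrow> g p \<noteq> 0" "C_on n f S" "C_on n g S"
  shows "C_on n (\<lambda>p. f p / g p) S"
  using C_on_mult[OF assms(1,3) C_on_inverse[OF assms(1,2,4)]] by (simp add: divide_inverse)

lemma C_on_sqrt:
  assumes "open S" "\<And>p. p \<in> S \<Longrightarrow> f p > 0"
  shows "C_on n f S \<Longrightarrow> C_on n (\<lambda>p. sqrt (f p)) S"
proof (induction n)
  case 0
  then show ?case by (auto intro: continuous_on_real_sqrt)
next
  case (Suc n)
  have "C_on n f S" using Suc.prems C_on_Suc_imp by blast
  then have root: "C_on n (\<lambda>p. sqrt (f p)) S" by (rule Suc.IH)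
  have inv: "C_on n (\<lambda>p. inverse (sqrt (f p))) S"
    using assms by (intro C_on_inverse root) force+
  show ?case
  proof (rule C_on_SucI[where f' = "\<lambda>b p. (inverse (sqrt (f p)) * (1/2)) * pd b f p"])
    fix p assume p: "p \<in> S"
    have d: "(sqrt has_real_derivative inverse (sqrt (f p)) * (1/2)) (at (f p))"
      using DERIV_real_sqrt[OF assms(2)[OF p]] by simp
    obtain f' where f': "(f has_derivative f') (at p)"
      using Suc.prems p unfolding C_on.simps differentiable_def by blast
    show "(\<lambda>p. sqrt (f p)) differentiable (at p)"
      using has_derivative_compose[OF f' d[unfolded has_field_derivative_def]]
      unfolding differentiable_def by blast
    fix b
    show "has_pd b (\<lambda>p. sqrt (f p)) ((inverse (sqrt (f p)) * (1/2)) * pd b f p) p"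
      by (rule has_pd_compose[OF C_on_imp_has_pd[OF Suc.prems p] d])
  next
    fix b :: 'a assume "b \<in> Basis"
    then have "C_on n (pd b f) S" using Suc.prems by simp
    then show "C_on n (\<lambda>p. (inverse (sqrt (f p)) * (1/2)) * pd b f p) S"
      by (intro C_on_mult C_on_const inv assms(1))
  qed (rule assms(1))
qed

lemma pd_commute:
  assumes "open S" "C_on 2 f S" "a \<in> Basis" "b \<in> Basis" "p \<in> S"
  shows "pd a (pd b f) p = pd b (pd a f) p"
proof -
  have C: "C_on (Suc (Suc 0)) f S" using assms(2) by (simp add: numeral_2_eq_2)
  show ?thesis
    by (rule mixed_derivatives_eq[where S = S and f = f and a = b and b = a
          and fa = "pd b f" and fb = "pd a f"])
       (use C assms in \<open>auto intro: differentiable_imp_has_pd\<close>)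
qed

text \<open>
  Commutation of derivatives one order below what Schwarz's theorem demands: \<open>c\<close> is only once
  differentiable, but it does not vary in the direction \<open>e\<close>, and neither does its derivative along
  \<open>u\<close>. Differentiating by the product rule in either order, every term containing a derivative of
  \<open>c\<close> along \<open>e\<close> drops out, and what remains differs only by the order of derivatives of the
  twice differentiable \<open>\<alpha>\<close> and \<open>\<beta>\<close>. The coefficients $N^k_n$ have this shape, with
  $c = k_n$.
\<close>

lemma has_pd_pd_affine:
  assumes S: "open S" and p: "p \<in> S" and u: "u \<in> Basis" and e: "e \<in> Basis"
    and A: "C_on 2 \<alpha> S" and B: "C_on 2 \<beta> S" and c: "C_on 1 c S"
    and c0: "\<And>q. q \<in> S \<Longrightarrow> pd e c q = 0"
    and c1: "has_pd e (pd u c) 0 p"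
    and f: "\<And>q. q \<in> S \<Longrightarrow> f q = \<alpha> q + \<beta> q * c q"
  shows "has_pd e (pd u f) (pd u (pd e f) p) p"
proof -
  have pdf: "pd v f q = pd v \<alpha> q + (pd v \<beta> q * c q + \<beta> q * pd v c q)" if "q \<in> S" for v q
  proof -
    have "has_pd v (\<lambda>q. \<alpha> q + \<beta> q * c q) (pd v \<alpha> q + (pd v \<beta> q * c q + \<beta> q * pd v c q)) q"
      using A B c that
      by (intro has_pd_add has_pd_mult differentiable_imp_has_pd) (auto simp: numeral_2_eq_2)
    from has_pd_cong[OF S that _ this, of f] f show ?thesis by (simp add: has_pd_imp_pd)
  qed
  have d: "has_pd v (pd w \<alpha>) (pd v (pd w \<alpha>) p) p" "has_pd v (pd w \<beta>) (pd v (pd w \<beta>) p) p"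
    "has_pd v \<beta> (pd v \<beta> p) p" "has_pd v c (pd v c p) p" if "w \<in> Basis" for v w
    using A B c that p by (auto intro!: differentiable_imp_has_pd simp: numeral_2_eq_2)
  have "has_pd u (\<lambda>q. pd e \<alpha> q + pd e \<beta> q * c q)
      (pd u (pd e \<alpha>) p + (pd u (pd e \<beta>) p * c p + pd e \<beta> p * pd u c p)) p"
    by (intro has_pd_add has_pd_mult d) (use e in auto)
  from has_pd_cong[OF S p _ this, of "pd e f"]
  have ue: "pd u (pd e f) p = pd u (pd e \<alpha>) p + (pd u (pd e \<beta>) p * c p + pd e \<beta> p * pd u c p)"
    by (simp add: has_pd_imp_pd pdf c0)
  have "has_pd e (\<lambda>q. pd u \<alpha> q + (pd u \<beta> q * c q + \<beta> q * pd u c q))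
     (pd e (pd u \<alpha>) p + ((pd e (pd u \<beta>) p * c p + pd u \<beta> p * pd e c p)
        + (pd e \<beta> p * pd u c p + \<beta> p * 0))) p"
    by (intro has_pd_add has_pd_mult d c1) (use u in auto)
  from has_pd_cong[OF S p _ this, of "pd u f"]
  have "has_pd e (pd u f) (pd e (pd u \<alpha>) p + ((pd e (pd u \<beta>) p * c p + pd u \<beta> p * pd e c p)
        + (pd e \<beta> p * pd u c p + \<beta> p * 0))) p"
    by (simp add: pdf)
  moreover have "pd e (pd u \<alpha>) p = pd u (pd e \<alpha>) p" "pd e (pd u \<beta>) p = pd u (pd e \<beta>) p"
    using pd_commute S A B e u p by blast+
  ultimately show ?thesis using ue c0[OF p] by simp
qed

section \<open>The frame of a two-dimensional Finsler metric\<close>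

locale finsler_chart =
  fixes U :: "(real^2) set" and W :: "tpoint set"
    and F \<theta> :: "tpoint \<Rightarrow> real" and \<kappa> :: "real^2 \<Rightarrow> real^2"
  assumes region: "conic_region U W"
    and metric: "finsler_metric_on W F"
    and angle: "angle_function_on W F \<theta>"
    and covector: "covector_field_on U \<kappa>"
begin

lemma open_W: "open W"
  using region by (simp add: conic_region_def)

lemma C4_F: "C_on 4 F W" and F_pos: "p \<in> W \<Longrightarrow> F p > 0"
  using metric by (auto simp: finsler_metric_on_def)

lemma C3_\<theta>: "C_on 3 \<theta> W"
  using angle by (simp add: angle_function_on_def)

lemma horizontal_Basis: "(axis i 1, 0) \<in> (Basis :: tpoint set)"
  and vertical_Basis: "(0, axis i 1) \<in> (Basis :: tpoint set)"
  by (auto simp: Basis_prod_def axis_in_Basis_iff)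

lemma C_on_dx: "C_on (Suc n) f S \<Longrightarrow> C_on n (dx i f) S"
  unfolding dx_def by (rule C_on_pd[OF _ horizontal_Basis])

lemma C_on_dy: "C_on (Suc n) f S \<Longrightarrow> C_on n (dy i f) S"
  unfolding dy_def by (rule C_on_pd[OF _ vertical_Basis])

lemma has_pd_dy: "C_on 1 f W \<Longrightarrow> p \<in> W \<Longrightarrow> has_pd (0, axis i 1) f (dy i f p) p"
  unfolding dy_def by (rule C1_has_pd)

lemma dy_cong: "p \<in> W \<Longrightarrow> (\<And>q. q \<in> W \<Longrightarrow> f q = h q) \<Longrightarrow> dy i f p = dy i h p"
  unfolding dy_def by (rule pd_cong[OF open_W])

lemma dy_eqI:
  "p \<in> W \<Longrightarrow> (\<And>q. q \<in> W \<Longrightarrow> h q = f q) \<Longrightarrow> has_pd (0, axis i 1) h D p \<Longrightarrow> dy i f p = D"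
  unfolding dy_def using has_pd_cong[OF open_W] has_pd_imp_pd by blast

lemma dy_dy_commute: "C_on 2 f W \<Longrightarrow> p \<in> W \<Longrightarrow> dy i (dy j f) p = dy j (dy i f) p"
  unfolding dy_def by (rule pd_commute[OF open_W _ vertical_Basis vertical_Basis])

lemma dx_dy_commute: "C_on 2 f W \<Longrightarrow> p \<in> W \<Longrightarrow> dx i (dy j f) p = dy j (dx i f) p"
  unfolding dy_def dx_def by (rule pd_commute[OF open_W _ horizontal_Basis vertical_Basis])

lemma dx_dx_commute: "C_on 2 f W \<Longrightarrow> p \<in> W \<Longrightarrow> dx i (dx j f) p = dx j (dx i f) p"
  unfolding dx_def by (rule pd_commute[OF open_W _ horizontal_Basis horizontal_Basis])

lemma C_on_fibre_coordinate: "C_on n (\<lambda>p. snd p $ k) W" for k :: 2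
  by (rule C_on_bounded_linear[OF open_W])
     (rule bounded_linear_compose[OF bounded_linear_vec_nth bounded_linear_snd])

lemma has_pd_fibre_coordinate:
  "has_pd (0, axis i 1) (\<lambda>p. snd p $ k) (if i = k then 1 else 0) p"
  for i k :: 2 and p :: tpoint
proof -
  have "((\<lambda>p :: tpoint. snd p $ k) has_derivative (\<lambda>p. snd p $ k)) (at p)"
    by (rule bounded_linear_imp_has_derivative)
       (rule bounded_linear_compose[OF bounded_linear_vec_nth bounded_linear_snd])
  from has_derivative_imp_has_pd[OF this, of "(0, axis i 1)"] show ?thesis
    by (simp add: axis_def eq_commute)
qed

lemma C3_dF: "C_on 3 (dy i F) W" "C_on 3 (dx i F) W"
  using C_on_dy[of 3 F W] C_on_dx[of 3 F W] C4_F by (simp_all add: eval_nat_numeral)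

lemma C2_d\<theta>: "C_on 2 (dy i \<theta>) W" "C_on 2 (dx i \<theta>) W"
  using C_on_dy[of 2 \<theta> W] C_on_dx[of 2 \<theta> W] C3_\<theta> by (simp_all add: eval_nat_numeral)

lemma C_on_F: "n \<le> 4 \<Longrightarrow> C_on n F W"
  using C_on_le[OF C4_F] .

text \<open>
  Euler's relation: the derivative of \<open>F\<close> along the radial direction \<open>(0, y)\<close> is read off from
  homogeneity on the ray, and from the total derivative as a combination of the two fibre derivatives.
\<close>

lemma euler_F:
  assumes "p \<in> W"
  shows "snd p $ 1 * dy 1 F p + snd p $ 2 * dy 2 F p = F p"
proof -
  obtain x y where p: "p = (x, y)" by force
  have hom: "F (x, t *\<^sub>R y) = t * F (x, y)" if "t > 0" for t
    using metric assms that unfolding finsler_metric_on_def p by blast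
  have "F differentiable (at p)"
    using C_on_F[of 1] assms by simp
  then have "pd (y $ 1 *\<^sub>R (0, axis 1 1) + y $ 2 *\<^sub>R (0, axis 2 1)) F p
      = y $ 1 * dy 1 F p + y $ 2 * dy 2 F p"
    unfolding dy_def by (rule pd_linear_combination)
  moreover have "y $ 1 *\<^sub>R (0, axis 1 1) + y $ 2 *\<^sub>R (0, axis 2 1) = (0 :: real^2, y)"
    by (simp add: vec_eq_iff forall_2 axis_def)
  moreover have "pd (0, y) F p = F p"
  proof -
    have "\<forall>\<^sub>F t in nhds (0 :: real). - 1 < t"
      by (rule eventually_nhds_in_open[of "{- 1<..}", simplified]) auto
    then have "\<forall>\<^sub>F t in nhds 0. F (p + t *\<^sub>R (0, y)) = (1 + t) * F p"
      by eventually_elim (use hom[of "1 + t" for t] in \<open>simp add: p algebra_simps\<close>)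
    moreover have "((\<lambda>t. (1 + t) * F p) has_real_derivative F p) (at 0)"
      by (auto intro!: derivative_eq_intros)
    ultimately have "((\<lambda>t. F (p + t *\<^sub>R (0, y))) has_real_derivative F p) (at 0)"
      using DERIV_cong_ev[of 0 0 "\<lambda>t. F (p + t *\<^sub>R (0, y))" "\<lambda>t. (1 + t) * F p" "F p" "F p"] by blast
    then show ?thesis unfolding pd_def by (rule DERIV_imp_deriv)
  qed
  ultimately show ?thesis by (simp add: p)
qed

lemma hessian_F_null:
  assumes "p \<in> W"
  shows "snd p $ 1 * dy i (dy 1 F) p + snd p $ 2 * dy i (dy 2 F) p = 0"
proof -
  have "dy i F p = ((if i = 1 then 1 else 0) * dy 1 F p + snd p $ 1 * dy i (dy 1 F) p)
      + ((if i = 2 then 1 else 0) * dy 2 F p + snd p $ 2 * dy i (dy 2 F) p)"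
    by (rule dy_eqI[OF assms euler_F], assumption,
        intro has_pd_add has_pd_mult has_pd_fibre_coordinate has_pd_dy[OF _ assms] C_on_le[OF C3_dF(1)])
       simp_all
  then show ?thesis using exhaust_2[of i] by auto
qed

lemma C3_y_low: "C_on 3 (y_low F i) W"
  unfolding y_low_def[abs_def] by (intro C_on_mult open_W C_on_F C3_dF) simp

lemma C2_g_low: "C_on 2 (g_low F i j) W"
proof -
  have "C_on 2 (dy j (y_low F i)) W"
    using C_on_dy[of 2 "y_low F i" W] C3_y_low by (simp add: eval_nat_numeral)
  moreover have "g_low F i j = dy j (y_low F i)"
    by (rule ext) (simp add: g_low_def)
  ultimately show ?thesis by simp
qed

lemma g_low_eq:
  assumes "p \<in> W"
  shows "g_low F i j p = dy j F p * dy i F p + F p * dy j (dy i F) p"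
  unfolding g_low_def
  by (rule dy_eqI[OF assms, where h = "\<lambda>p. F p * dy i F p"])
     (auto intro!: has_pd_mult has_pd_dy[OF _ assms] C_on_le[OF C3_dF(1)] C_on_F simp: y_low_def)

lemma g_low_sym: "p \<in> W \<Longrightarrow> g_low F i j p = g_low F j i p"
  using g_low_eq dy_dy_commute[OF C_on_F] by simp

lemma g_low_fibre:
  assumes "p \<in> W"
  shows "snd p $ 1 * g_low F i 1 p + snd p $ 2 * g_low F i 2 p = y_low F i p"
proof -
  have "snd p $ 1 * g_low F i 1 p + snd p $ 2 * g_low F i 2 p
     = (snd p $ 1 * dy 1 F p + snd p $ 2 * dy 2 F p) * dy i F p
       + F p * (snd p $ 1 * dy i (dy 1 F) p + snd p $ 2 * dy i (dy 2 F) p)"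
    using dy_dy_commute[OF C_on_F assms, of i]
    by (simp add: g_low_eq[OF assms] algebra_simps)
  then show ?thesis
    using euler_F[OF assms] hessian_F_null[OF assms] by (simp add: y_low_def)
qed

lemma dg_sym_outer:
  assumes "p \<in> W"
  shows "dy k (g_low F i j) p = dy k (g_low F j i) p"
  by (rule dy_cong[OF assms]) (rule g_low_sym)

text \<open>
  Since $g_{ij} = \partial y_i/\partial y^j$, this is the symmetry of the second derivatives of
  $y_i$. Together with the symmetry of $g$ it makes the Cartan tensor totally symmetric.
\<close>

lemma dg_sym_inner:
  assumes "p \<in> W"
  shows "dy k (g_low F i j) p = dy j (g_low F i k) p"
proof -
  have "dy k (dy j (y_low F i)) p = dy j (dy k (y_low F i)) p"
    by (rule dy_dy_commute[OF C_on_le[OF C3_y_low] assms]) simp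
  moreover have "dy j (y_low F i) = g_low F i j" for i j
    by (rule ext) (simp add: g_low_def)
  ultimately show ?thesis by simp
qed

text \<open>
  Differentiating $g_{ij} y^j = y_i$ in $y^k$, the two terms without a derivative of $g$ cancel. Hence
  the Cartan tensor annihilates the radial direction.
\<close>

lemma dg_fibre_null:
  assumes "p \<in> W"
  shows "snd p $ 1 * dy k (g_low F i 1) p + snd p $ 2 * dy k (g_low F i 2) p = 0"
proof -
  have "dy k (y_low F i) p
    = ((if k = 1 then 1 else 0) * g_low F i 1 p + snd p $ 1 * dy k (g_low F i 1) p)
      + ((if k = 2 then 1 else 0) * g_low F i 2 p + snd p $ 2 * dy k (g_low F i 2) p)"
    by (rule dy_eqI[OF assms g_low_fibre], assumption,
        intro has_pd_add has_pd_mult has_pd_fibre_coordinate has_pd_dy[OF _ assms] C_on_le[OF C2_g_low])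
       simp_all
  then show ?thesis using exhaust_2[of k] by (auto simp: g_low_def)
qed

definition gdet :: "tpoint \<Rightarrow> real" where
  "gdet p = det (g_mat F p)"

lemma gdet_eq: "p \<in> W \<Longrightarrow> gdet p = g_low F 1 1 p * g_low F 2 2 p - g_low F 1 2 p * g_low F 1 2 p"
  using g_low_sym[of p 2 1] by (simp add: gdet_def det_2 g_mat_def)

lemma gdet_pos:
  assumes "p \<in> W"
  shows "gdet p > 0"
proof -
  have q: "v $ 1 * (g_low F 1 1 p * v $ 1 + g_low F 1 2 p * v $ 2)
      + v $ 2 * (g_low F 1 2 p * v $ 1 + g_low F 2 2 p * v $ 2) > 0" if "v \<noteq> 0" for v :: "real^2"
  proof -
    have "v \<bullet> (g_mat F p *v v) > 0"
      using metric assms that by (auto simp: finsler_metric_on_def)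
    then show ?thesis
      using g_low_sym[OF assms, of 2 1]
      by (simp add: g_mat_def inner_vec_def sum_2 matrix_vector_mult_def)
  qed
  have g11: "g_low F 1 1 p > 0"
    using q[of "vector [1, 0]"] by (simp add: vec_eq_iff forall_2)
  \<comment> \<open>On this vector the quadratic form takes the value $g_{11} \det g$.\<close>
  have "vector [- g_low F 1 2 p, g_low F 1 1 p] \<noteq> (0 :: real^2)"
    using g11 by (simp add: vec_eq_iff forall_2)
  from q[OF this] have "g_low F 1 1 p * gdet p > 0"
    by (simp add: gdet_eq[OF assms] algebra_simps)
  with g11 show ?thesis by (simp add: zero_less_mult_iff)
qed

lemma C2_gdet: "C_on 2 gdet W"
  by (rule C_on_cong[OF open_W _ C_on_diff[OF open_W C_on_mult[OF open_W] C_on_mult[OF open_W]]])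
     (auto simp: gdet_eq intro: C2_g_low)

lemma m_low_eq:
  "m_low F 1 p = - sqrt (gdet p) * l_up F 2 p" "m_low F 2 p = sqrt (gdet p) * l_up F 1 p"
  by (simp_all add: m_low_def eps_low_def sum_2 perm_symbol_def gdet_def)

lemma l_low_eq: "p \<in> W \<Longrightarrow> l_low F i p = g_low F i 1 p * l_up F 1 p + g_low F i 2 p * l_up F 2 p"
  using g_low_fibre[of p i] F_pos[of p]
  by (simp add: l_low_def l_up_def y_low_def field_simps)

lemma l_norm: "p \<in> W \<Longrightarrow> l_up F 1 p * l_low F 1 p + l_up F 2 p * l_low F 2 p = 1"
  using euler_F[of p] F_pos[of p] by (simp add: l_low_def l_up_def field_simps)

text \<open>
  Raising the index of $m_i$ amounts to lowering that of $l^k$: the inverse of a symmetric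
  two-by-two matrix is, up to the determinant, the matrix conjugated by the permutation symbol. These formulas make it
  visible that $m^n$ is twice continuously differentiable.
\<close>

lemma m_up_eq:
  assumes "p \<in> W"
  shows "m_up F 1 p = - l_low F 2 p / sqrt (gdet p)" "m_up F 2 p = l_low F 1 p / sqrt (gdet p)"
proof -
  define s where "s = sqrt (gdet p)"
  have s: "s > 0" "s * s = gdet p" using gdet_pos[OF assms] by (simp_all add: s_def)
  have "invertible (g_mat F p)"
    using gdet_pos[OF assms] by (simp add: invertible_det_nz gdet_def)
  then have inv: "g_mat F p ** matrix_inv (g_mat F p) = mat 1"
    unfolding invertible_def matrix_inv_def by (rule someI2_ex) simp
  define v :: "real^2" where "v = (\<chi> i. m_low F i p)"
  define w where "w = matrix_inv (g_mat F p) *v v"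
  have w: "w $ i = m_up F i p" for i
    by (simp add: w_def v_def m_up_def g_up_def matrix_vector_mult_def)
  have "g_mat F p *v w = v"
    by (simp add: w_def matrix_vector_mul_assoc inv)
  then have "(g_mat F p *v w) $ i = v $ i" for i by simp
  then have eqs: "g_low F i 1 p * m_up F 1 p + g_low F i 2 p * m_up F 2 p = m_low F i p" for i
    by (simp add: matrix_vector_mult_def sum_2 g_mat_def w v_def)
  have e1: "g_low F 1 1 p * m_up F 1 p + g_low F 1 2 p * m_up F 2 p = - s * l_up F 2 p"
    and e2: "g_low F 1 2 p * m_up F 1 p + g_low F 2 2 p * m_up F 2 p = s * l_up F 1 p"
    using eqs[of 1] eqs[of 2] g_low_sym[OF assms, of 2 1] by (simp_all add: m_low_eq s_def)
  have "s * (s * m_up F 1 p) = s * - l_low F 2 p"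
    unfolding mult.assoc[symmetric] s(2) gdet_eq[OF assms] l_low_eq[OF assms] g_low_sym[OF assms, of 2 1] using e1 e2 by algebra
  moreover have "s * (s * m_up F 2 p) = s * l_low F 1 p"
    unfolding mult.assoc[symmetric] s(2) gdet_eq[OF assms] l_low_eq[OF assms] g_low_sym[OF assms, of 2 1] using e1 e2 by algebra
  ultimately have "s * m_up F 1 p = - l_low F 2 p" "s * m_up F 2 p = l_low F 1 p"
    using s(1) by (metis mult_left_cancel less_irrefl)+
  then show "m_up F 1 p = - l_low F 2 p / sqrt (gdet p)" "m_up F 2 p = l_low F 1 p / sqrt (gdet p)"
    unfolding s_def[symmetric] using s(1) by (simp_all add: field_simps)
qed

lemma frame_dual:
  assumes "p \<in> W"
  shows "m_up F 1 p * m_low F 1 p + m_up F 2 p * m_low F 2 p = 1"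
    and "l_up F 1 p * m_low F 1 p + l_up F 2 p * m_low F 2 p = 0"
    and "m_up F 1 p * l_low F 1 p + m_up F 2 p * l_low F 2 p = 0"
  using l_norm[OF assms] gdet_pos[OF assms]
  by (simp_all add: m_up_eq[OF assms] m_low_eq field_simps)

lemma frame_complete:
  assumes "p \<in> W"
  shows "l_up F n p * l_low F k p + m_up F n p * m_low F k p = (if n = k then 1 else 0)"
  using l_norm[OF assms] gdet_pos[OF assms] exhaust_2[of n] exhaust_2[of k]
  by (auto simp: m_up_eq[OF assms] m_low_eq field_simps)

text \<open>
  Equality may be tested on the components with respect to $l$ and $m$; in coordinates it is a polynomial
  consequence of $g_{ij} l^i l^j = 1$ and of the normalization of $m$ by $\sqrt{\det g}$.
\<close>

lemma g_low_frame:
  assumes "p \<in> W"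
  shows "g_low F i j p = l_low F i p * l_low F j p + m_low F i p * m_low F j p"
proof -
  define L1 L2 a b c s where "L1 = l_up F 1 p" "L2 = l_up F 2 p"
    "a = g_low F 1 1 p" "b = g_low F 1 2 p" "c = g_low F 2 2 p" "s = sqrt (gdet p)"
  note defs = this
  have s: "s * s = a * c - b * b"
    using gdet_pos[OF assms] gdet_eq[OF assms] by (simp add: defs)
  have ll: "l_low F 1 p = a * L1 + b * L2" "l_low F 2 p = b * L1 + c * L2"
    using l_low_eq[OF assms] g_low_sym[OF assms, of 2 1] by (simp_all add: defs)
  have m: "m_low F 1 p = - s * L2" "m_low F 2 p = s * L1"
    by (simp_all add: m_low_eq defs)
  have n: "L1 * (a * L1 + b * L2) + L2 * (b * L1 + c * L2) = 1"
    using l_norm[OF assms] ll by (simp add: defs)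
  have "a = (a * L1 + b * L2) * (a * L1 + b * L2) + (- s * L2) * (- s * L2)"
    "b = (a * L1 + b * L2) * (b * L1 + c * L2) + (- s * L2) * (s * L1)"
    "c = (b * L1 + c * L2) * (b * L1 + c * L2) + (s * L1) * (s * L1)"
    using s n by algebra+
  then show ?thesis
    using exhaust_2[of i] exhaust_2[of j] g_low_sym[OF assms, of 2 1] ll m
    by (auto simp: defs(3-5)[symmetric] mult.commute)
qed

text \<open>
  A totally symmetric tensor of rank three on a plane that annihilates a nonzero vector $l$ is a
  multiple of the cube of the covector $m$ that annihilates $l$. The factor is unique since
  $m \neq 0$, so the definite description that defines the main scalar is meaningful.
\<close>

lemma A_low_eq_main_scalar:
  assumes "p \<in> W"
  shows "A_low F i j k p = main_scalar F p * m_low F i p * m_low F j p * m_low F k p"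
proof -
  define L1 L2 s where "L1 = l_up F 1 p" "L2 = l_up F 2 p" "s = sqrt (gdet p)"
  note defs = this
  have s: "s > 0" using gdet_pos[OF assms] by (simp add: defs)
  have m: "m_low F 1 p = - s * L2" "m_low F 2 p = s * L1"
    by (simp_all add: m_low_eq defs)
  define c where "c i j k = A_low F i j k p" for i j k
  have sym: "c i j k = c j i k" "c i j k = c i k j" for i j k
    using dg_sym_outer[OF assms, of k i j] dg_sym_inner[OF assms, of k i j]
    by (simp_all add: c_def A_low_def cartan_def)
  have null: "L1 * c i 1 k + L2 * c i 2 k = 0" for i k
  proof -
    have "L1 * c i 1 k + L2 * c i 2 k
      = (snd p $ 1 * dy k (g_low F i 1) p + snd p $ 2 * dy k (g_low F i 2) p) / 2"
      using F_pos[OF assms] by (simp add: c_def A_low_def cartan_def defs l_up_def field_simps)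
    then show ?thesis using dg_fibre_null[OF assms] by simp
  qed
  have n: "L1 * c 1 1 1 + L2 * c 1 1 2 = 0" "L1 * c 1 1 2 + L2 * c 1 2 2 = 0"
    "L1 * c 1 2 2 + L2 * c 2 2 2 = 0"
    using null[of 1 1] null[of 1 2] null[of 2 2] sym by metis+
  have c_sorted: "c 1 2 1 = c 1 1 2" "c 2 1 1 = c 1 1 2" "c 2 1 2 = c 1 2 2" "c 2 2 1 = c 1 2 2"
    using sym by metis+
  have ne: "L1 \<noteq> 0 \<or> L2 \<noteq> 0"
    using l_norm[OF assms] by (auto simp: defs)
  obtain I where I: "c 1 1 1 = I * (- s * L2) * (- s * L2) * (- s * L2)"
    "c 1 1 2 = I * (- s * L2) * (- s * L2) * (s * L1)"
    "c 1 2 2 = I * (- s * L2) * (s * L1) * (s * L1)"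
    "c 2 2 2 = I * (s * L1) * (s * L1) * (s * L1)"
  proof (cases "L1 = 0")
    case True
    then have "L2 \<noteq> 0" using ne by simp
    then show ?thesis
      using n True s that[of "c 1 1 1 / ((- s * L2) * (- s * L2) * (- s * L2))"] by simp
  next
    case False
    then have "c 1 2 2 = - L2 * c 2 2 2 / L1" "c 1 1 2 = - L2 * c 1 2 2 / L1" "c 1 1 1 = - L2 * c 1 1 2 / L1"
      using n by (simp_all add: field_simps)
    then have "c 1 2 2 = - L2 * c 2 2 2 / L1" "c 1 1 2 = L2 * L2 * c 2 2 2 / (L1 * L1)"
      "c 1 1 1 = - L2 * L2 * L2 * c 2 2 2 / (L1 * L1 * L1)"
      by simp_all
    then show ?thesis
      using False s by (intro that[of "c 2 2 2 / ((s * L1) * (s * L1) * (s * L1))"]) (simp_all add: field_simps)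
  qed
  have I': "A_low F i j k p = I * m_low F i p * m_low F j p * m_low F k p" for i j k
    unfolding c_def[symmetric]
    using exhaust_2[of i] exhaust_2[of j] exhaust_2[of k] I m c_sorted by auto
  have "main_scalar F p = I"
    unfolding main_scalar_def
  proof (rule the_equality)
    fix J assume J: "\<forall>i j k. A_low F i j k p = J * m_low F i p * m_low F j p * m_low F k p"
    have "J * (m_low F i p * m_low F i p * m_low F i p) = I * (m_low F i p * m_low F i p * m_low F i p)" for i
      using J I'[of i i i] by (simp add: mult.assoc)
    from this[of 1] this[of 2] show "J = I" using ne s m by auto
  qed (simp add: I')
  then show ?thesis using I' by simp
qed

text \<open>
  The derivative of the determinant, with $\partial_k g_{ij} = 2 I m_i m_j m_k / F$, contracts
  $m_i m_j$ with the cofactor matrix of $g$; in terms of $l$ this is $\det g \cdot g_{ij} l^i l^j = \det g$.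
\<close>

lemma dy_gdet:
  assumes "p \<in> W"
  shows "dy k gdet p = 2 * main_scalar F p * m_low F k p * gdet p / F p"
proof -
  define L1 L2 a b c s f I where "L1 = l_up F 1 p" "L2 = l_up F 2 p"
    "a = g_low F 1 1 p" "b = g_low F 1 2 p" "c = g_low F 2 2 p" "s = sqrt (gdet p)"
    "f = F p" "I = main_scalar F p"
  note defs = this
  have f: "f > 0" using F_pos[OF assms] by (simp add: defs)
  have s: "s * s = gdet p" using gdet_pos[OF assms] by (simp add: defs)
  have dg: "dy k (g_low F i j) p = 2 * I * m_low F i p * m_low F j p * m_low F k p / f" for i j
    using A_low_eq_main_scalar[OF assms, of i j k] f
    by (simp add: A_low_def cartan_def defs field_simps)
  have m: "m_low F 1 p = - s * L2" "m_low F 2 p = s * L1"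
    by (simp_all add: m_low_eq defs)
  have ll: "l_low F 1 p = a * L1 + b * L2" "l_low F 2 p = b * L1 + c * L2"
    using l_low_eq[OF assms] g_low_sym[OF assms, of 2 1] by (simp_all add: defs)
  have n: "L1 * (a * L1 + b * L2) + L2 * (b * L1 + c * L2) = 1"
    using l_norm[OF assms] ll by (simp add: defs)
  have "dy k gdet p = (dy k (g_low F 1 1) p * c + a * dy k (g_low F 2 2) p)
      - (dy k (g_low F 1 2) p * b + b * dy k (g_low F 1 2) p)"
    unfolding defs
    by (rule dy_eqI[OF assms gdet_eq[symmetric]], assumption,
        intro has_pd_diff has_pd_mult has_pd_dy[OF _ assms] C_on_le[OF C2_g_low])
       simp_all
  also have "\<dots> = 2 * I * m_low F k p / f
      * ((- s * L2) * (- s * L2) * c + a * (s * L1) * (s * L1) - 2 * b * (- s * L2) * (s * L1))"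
    unfolding dg m using f by (simp add: field_simps)
  also have "(- s * L2) * (- s * L2) * c + a * (s * L1) * (s * L1) - 2 * b * (- s * L2) * (s * L1) = gdet p"
    unfolding s[symmetric] using n by algebra
  finally show ?thesis by (simp add: defs)
qed

text \<open>
  The components $F m^n$ of $\partial/\partial\theta$ in the polar coordinates $(F, \theta)$ of a
  tangent plane: this vector annihilates $F$ and sends $\theta$ to 1.
\<close>

definition angular :: "2 \<Rightarrow> tpoint \<Rightarrow> real" where
  "angular n p = F p * m_up F n p"

lemma angular_eq:
  assumes "p \<in> W"
  shows "- y_low F 2 p / sqrt (gdet p) = angular 1 p" "y_low F 1 p / sqrt (gdet p) = angular 2 p"
  by (simp_all add: angular_def m_up_eq[OF assms] y_low_def l_low_def)

lemma C2_angular: "C_on 2 (angular n) W"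
proof -
  have root: "C_on 2 (\<lambda>p. sqrt (gdet p)) W"
    by (rule C_on_sqrt[OF open_W gdet_pos C2_gdet])
  have ne: "sqrt (gdet p) \<noteq> 0" if "p \<in> W" for p using gdet_pos[OF that] by simp
  have y: "C_on 2 (y_low F i) W" for i by (rule C_on_le[OF C3_y_low]) simp
  have "C_on 2 (angular 1) W" "C_on 2 (angular 2) W"
    by (rule C_on_cong[OF open_W angular_eq(1) C_on_divide[OF open_W ne C_on_minus[OF open_W y] root]],
        assumption+)
       (rule C_on_cong[OF open_W angular_eq(2) C_on_divide[OF open_W ne y root]], assumption+)
  then show ?thesis using exhaust_2[of n] by auto
qed

text \<open>
  By \<open>angular_eq\<close>, the numerators differentiate to $g_{ik} = l_i l_k + m_i m_k$, which
  gives the first two terms, and $1/\sqrt{\det g}$ contributes the term with the main scalar.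
\<close>

lemma dy_angular:
  assumes "p \<in> W"
  shows "dy k (angular n) p = l_low F k p * m_up F n p - l_up F n p * m_low F k p
           - main_scalar F p * m_low F k p * m_up F n p"
proof -
  define s I f where "s = sqrt (gdet p)" "I = main_scalar F p" "f = F p"
  note defs = this
  have s: "s > 0" "s * s = gdet p" "sqrt (gdet p) = s" using gdet_pos[OF assms] by (simp_all add: defs)
  have f: "f > 0" using F_pos[OF assms] by (simp add: defs)
  have "has_pd (0, axis k 1) (\<lambda>p. inverse (sqrt (gdet p)))
      (- (inverse s * inverse s) * (inverse s / 2 * dy k gdet p)) p"
  proof -
    have "has_pd (0, axis k 1) (\<lambda>p. sqrt (gdet p)) (inverse (sqrt (gdet p)) / 2 * dy k gdet p) p"
      using DERIV_real_sqrt[OF gdet_pos[OF assms]]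
      by (intro has_pd_compose has_pd_dy[OF _ assms] C_on_le[OF C2_gdet]) auto
    moreover have "(inverse has_real_derivative - (inverse s * inverse s)) (at (sqrt (gdet p)))"
      using DERIV_inverse[of s UNIV] s by (simp add: power2_eq_square)
    ultimately have "has_pd (0, axis k 1) (\<lambda>p. inverse (sqrt (gdet p)))
        (- (inverse s * inverse s) * (inverse (sqrt (gdet p)) / 2 * dy k gdet p)) p"
      by (rule has_pd_compose)
    then show ?thesis by (simp only: s(3))
  qed
  moreover have "- (inverse s * inverse s) * (inverse s / 2 * dy k gdet p) = - I * m_low F k p / (f * s)"
    unfolding dy_gdet[OF assms] s(2)[symmetric] using s(1) f by (simp add: defs field_simps)
  ultimately have root: "has_pd (0, axis k 1) (\<lambda>p. inverse (sqrt (gdet p))) (- I * m_low F k p / (f * s)) p"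
    by simp
  have y: "has_pd (0, axis k 1) (y_low F i) (g_low F i k p) p" for i
    using has_pd_dy[OF C_on_le[OF C3_y_low] assms] by (simp add: g_low_def)
  have d1: "dy k (angular 1) p = - g_low F 2 k p * inverse s + - y_low F 2 p * (- I * m_low F k p / (f * s))"
    unfolding s(3)[symmetric]
    by (rule dy_eqI[OF assms _ has_pd_mult[OF has_pd_minus[OF y] root[unfolded s(3)[symmetric]]]])
       (simp add: angular_eq[symmetric] divide_inverse)
  have d2: "dy k (angular 2) p = g_low F 1 k p * inverse s + y_low F 1 p * (- I * m_low F k p / (f * s))"
    unfolding s(3)[symmetric]
    by (rule dy_eqI[OF assms _ has_pd_mult[OF y root[unfolded s(3)[symmetric]]]])
       (simp add: angular_eq[symmetric] divide_inverse)
  have y_l: "y_low F i p = f * l_low F i p" for i by (simp add: y_low_def l_low_def defs)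
  have "dy k (angular 1) p = l_low F k p * m_up F 1 p - l_up F 1 p * m_low F k p - I * m_low F k p * m_up F 1 p"
    unfolding d1 g_low_frame[OF assms] y_l m_up_eq[OF assms] m_low_eq(2) s(3)
    using s(1) f by (simp add: field_simps)
  moreover have "dy k (angular 2) p = l_low F k p * m_up F 2 p - l_up F 2 p * m_low F k p - I * m_low F k p * m_up F 2 p"
    unfolding d2 g_low_frame[OF assms] y_l m_up_eq[OF assms] m_low_eq(1) s(3)
    using s(1) f by (simp add: field_simps)
  ultimately show ?thesis using exhaust_2[of n] by (auto simp: defs)
qed

section \<open>The connection and its curvature\<close>

abbreviation "N \<equiv> N_coeff F \<theta> \<kappa>"
abbreviation "D \<equiv> D_coeff F \<theta> \<kappa>"
abbreviation "d \<equiv> d_op F \<theta> \<kappa>"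
abbreviation "M \<equiv> M_tensor F \<theta> \<kappa>"

text \<open>
  The covector field as a function on the tangent bundle, so that $d_n$ can be applied to it.
\<close>

definition \<kappa>_lift :: "2 \<Rightarrow> tpoint \<Rightarrow> real" where
  "\<kappa>_lift n p = \<kappa> (fst p) $ n"

lemma fst_in_U: "p \<in> W \<Longrightarrow> fst p \<in> U"
  using region by (auto simp: conic_region_def)

lemma pd_\<kappa>_lift: "pd (u, 0) (\<kappa>_lift n) = (\<lambda>p. pd u (\<lambda>x. \<kappa> x $ n) (fst p))"
  "pd (0, v) (\<kappa>_lift n) = (\<lambda>_. 0)"
  by (simp_all add: fun_eq_iff pd_def \<kappa>_lift_def)

lemma C1_\<kappa>_lift: "C_on 1 (\<kappa>_lift n) W"
proof -
  have C: "C_on 1 (\<lambda>x. \<kappa> x $ n) U" using covector by (simp add: covector_field_on_def)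
  have "\<kappa>_lift n differentiable (at p)" if p: "p \<in> W" for p
  proof -
    obtain f' where "((\<lambda>x. \<kappa> x $ n) has_derivative f') (at (fst p))"
      using C fst_in_U[OF p] unfolding differentiable_def One_nat_def C_on.simps by blast
    from has_derivative_compose[OF has_derivative_fst[OF has_derivative_ident] this]
    show ?thesis unfolding \<kappa>_lift_def[abs_def] differentiable_def by blast
  qed
  moreover have "continuous_on W (pd b (\<kappa>_lift n))" if b: "b \<in> Basis" for b
  proof -
    consider u where "b = (u, 0)" "u \<in> Basis" | v where "b = (0, v)"
      using b unfolding Basis_prod_def by blast
    then show ?thesis
    proof cases
      case 1
      then have "continuous_on U (pd u (\<lambda>x. \<kappa> x $ n))" using C by simp
      then show ?thesis unfolding 1 pd_\<kappa>_lift
        by (rule continuous_on_compose2) (auto intro: continuous_intros fst_in_U)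
    qed (simp add: pd_\<kappa>_lift)
  qed
  ultimately show ?thesis by simp
qed

text \<open>
  The part of $N^k_n$ without the covector field. Separating the two parts exhibits $N^k_n$ as a twice
  continuously differentiable function plus the product of another one with $k_n$.
\<close>

definition N_free :: "2 \<Rightarrow> 2 \<Rightarrow> tpoint \<Rightarrow> real" where
  "N_free k n p = - l_up F k p * dx n F p - angular k p * dx n \<theta> p"

lemma N_split: "N k n p = N_free k n p + angular k p * \<kappa>_lift n p"
  by (simp add: N_coeff_def N_free_def angular_def \<kappa>_lift_def algebra_simps)

lemma C2_N_free: "C_on 2 (N_free k n) W"
proof -
  have ne: "F p \<noteq> 0" if "p \<in> W" for p using F_pos[OF that] by simp
  have l: "C_on 2 (l_up F k) W"
    unfolding l_up_def[abs_def]
    by (rule C_on_divide[OF open_W ne C_on_fibre_coordinate C_on_F]) simp_all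
  have "C_on 2 (dx n F) W" by (rule C_on_le[OF C3_dF(2)]) simp
  then show ?thesis
    unfolding N_free_def[abs_def]
    by (intro C_on_diff C_on_mult C_on_minus open_W l C2_angular C2_d\<theta>)
qed

lemma C1_N: "C_on 1 (N k n) W"
proof -
  have "C_on 1 (\<lambda>p. N_free k n p + angular k p * \<kappa>_lift n p) W"
    by (intro C_on_add C_on_mult open_W C1_\<kappa>_lift C_on_le[OF C2_N_free] C_on_le[OF C2_angular]) simp_all
  then show ?thesis by (simp add: N_split[abs_def])
qed

lemma has_pd_N: "p \<in> W \<Longrightarrow> has_pd b (N k n) (pd b (N k n) p) p"
  by (rule C1_has_pd[OF C1_N])

lemma C1_dy_N: "C_on 1 (dy m (N k n)) W"
proof -
  have C1: "C_on 1 (N_free k n) W" "C_on 1 (angular k) W"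
    by (rule C_on_le[OF C2_N_free] C_on_le[OF C2_angular], simp)+
  have C1': "C_on 1 (dy m (N_free k n)) W" "C_on 1 (dy m (angular k)) W"
    using C2_N_free C2_angular C_on_dy[of 1 _ W] by (simp_all add: numeral_2_eq_2 del: C_on.simps)
  have C: "C_on 1 (\<lambda>p. dy m (N_free k n) p + dy m (angular k) p * \<kappa>_lift n p) W"
    by (intro C_on_add C_on_mult open_W C1' C1_\<kappa>_lift)
  have eq: "dy m (N_free k n) p + dy m (angular k) p * \<kappa>_lift n p = dy m (N k n) p" if "p \<in> W" for p
  proof -
    have "has_pd (0, axis m 1) (\<kappa>_lift n) 0 p"
      using has_pd_dy[OF C1_\<kappa>_lift that, of m n] by (simp add: dy_def pd_\<kappa>_lift)
    then have "dy m (N k n) p = dy m (N_free k n) p + (dy m (angular k) p * \<kappa>_lift n p + angular k p * 0)"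
      by (intro dy_eqI[OF that N_split[symmetric]] has_pd_add has_pd_mult has_pd_dy[OF _ that] C1)
    then show ?thesis by simp
  qed
  show ?thesis by (rule C_on_cong[OF open_W eq C])
qed

lemma fibre_derivative_commutes_on_N:
  assumes "p \<in> W" "b \<in> Basis"
  shows "has_pd (0, axis k 1) (pd b (N n j)) (pd b (dy k (N n j)) p) p"
  unfolding dy_def
proof (rule has_pd_pd_affine[OF open_W assms(1,2) vertical_Basis C2_N_free C2_angular C1_\<kappa>_lift _ _ N_split])
  show "pd (0, axis k 1) (\<kappa>_lift j) q = 0" for q by (simp add: pd_\<kappa>_lift)
  show "has_pd (0, axis k 1) (pd b (\<kappa>_lift j)) 0 p"
    using assms(2) by (auto simp: Basis_prod_def pd_\<kappa>_lift has_pd_def)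
qed

lemma has_pd_d:
  assumes "p \<in> W" "C_on 2 f W"
  shows "has_pd b (d j f) (pd b (dx j f) p
      + ((pd b (N 1 j) p * dy 1 f p + N 1 j p * pd b (dy 1 f) p)
       + (pd b (N 2 j) p * dy 2 f p + N 2 j p * pd b (dy 2 f) p))) p"
proof -
  have df: "has_pd b (dx i f) (pd b (dx i f) p) p" "has_pd b (dy i f) (pd b (dy i f) p) p" for i
    using assms C_on_dx[of 1 f W i] C_on_dy[of 1 f W i]
    by (auto intro!: C1_has_pd[of _ W] simp: numeral_2_eq_2 simp del: C_on.simps)
  have d_eq: "d j f = (\<lambda>p. dx j f p + (N 1 j p * dy 1 f p + N 2 j p * dy 2 f p))"
    by (simp add: fun_eq_iff d_op_def sum_2)
  show ?thesis
    unfolding d_eq by (intro has_pd_add has_pd_mult has_pd_N[OF assms(1)] df)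
qed

text \<open>
  Commuting second derivatives of \<open>f\<close> cancel in the antisymmetrization, leaving the derivatives of the
  coefficients $N$, which are collected in the tensor $M$.
\<close>

lemma commutator_d:
  assumes "p \<in> W" "C_on 2 f W"
  shows "d i (d j f) p - d j (d i f) p = M 1 i j p * dy 1 f p + M 2 i j p * dy 2 f p"
proof -
  note pd = has_pd_d[OF assms, THEN has_pd_imp_pd, folded dx_def dy_def]
  have dx: "dx i (d j f) p = dx i (dx j f) p
      + ((dx i (N 1 j) p * dy 1 f p + N 1 j p * dx i (dy 1 f) p)
       + (dx i (N 2 j) p * dy 2 f p + N 2 j p * dx i (dy 2 f) p))" for i j
    using pd[of "(axis i 1, 0)" j] by (simp add: dx_def)
  have dy: "dy i (d j f) p = dy i (dx j f) p
      + ((dy i (N 1 j) p * dy 1 f p + N 1 j p * dy i (dy 1 f) p)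
       + (dy i (N 2 j) p * dy 2 f p + N 2 j p * dy i (dy 2 f) p))" for i j
    using pd[of "(0, axis i 1)" j] by (simp add: dy_def)
  have dd: "d n h p = dx n h p + (N 1 n p * dy 1 h p + N 2 n p * dy 2 h p)" for n h
    by (simp add: d_op_def sum_2)
  show ?thesis
    unfolding M_tensor_def dd dx dy dx_dx_commute[OF assms(2,1), of j i]
      dx_dy_commute[OF assms(2,1)] dy_dy_commute[OF assms(2,1), of 2 1]
    by (simp add: algebra_simps)
qed

lemma d_cong:
  assumes "p \<in> W" "\<And>q. q \<in> W \<Longrightarrow> f q = h q"
  shows "d i f p = d i h p"
proof -
  have "pd b f p = pd b h p" for b by (rule pd_cong[OF open_W assms])
  then show ?thesis by (simp add: d_op_def dx_def dy_def)
qed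

text \<open>
  The component of $N_n$ along $l$ was chosen to cancel $\partial F/\partial x^n$, by $l^k l_k = 1$ and
  $m^k l_k = 0$.
\<close>

lemma d_F:
  assumes "p \<in> W"
  shows "d n F p = 0"
proof -
  have "d n F p = dx n F p
      - (l_up F 1 p * l_low F 1 p + l_up F 2 p * l_low F 2 p) * dx n F p
      - (m_up F 1 p * l_low F 1 p + m_up F 2 p * l_low F 2 p) * F p * (dx n \<theta> p - \<kappa> (fst p) $ n)"
    by (simp add: d_op_def sum_2 N_coeff_def l_low_def algebra_simps)
  then show ?thesis using l_norm[OF assms] frame_dual(3)[OF assms] by simp
qed

lemma dy_\<theta>: "p \<in> W \<Longrightarrow> dy n \<theta> p = m_low F n p / F p"
  using angle F_pos[of p] by (simp add: angle_function_on_def field_simps)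

text \<open>
  The component of $N_n$ along $m$ was chosen to replace $\partial \theta/\partial x^n$ by $k_n$,
  since $F\,\partial\theta/\partial y^k = m_k$, $m^k m_k = 1$ and $l^k m_k = 0$.
\<close>

lemma d_\<theta>:
  assumes "p \<in> W"
  shows "d n \<theta> p = \<kappa>_lift n p"
proof -
  have "d n \<theta> p = dx n \<theta> p
      - (l_up F 1 p * m_low F 1 p + l_up F 2 p * m_low F 2 p) * dx n F p / F p
      - (m_up F 1 p * m_low F 1 p + m_up F 2 p * m_low F 2 p) * (dx n \<theta> p - \<kappa> (fst p) $ n)"
    using F_pos[OF assms] by (simp add: d_op_def sum_2 N_coeff_def dy_\<theta>[OF assms] field_simps)
  then show ?thesis using frame_dual(1,2)[OF assms] by (simp add: \<kappa>_lift_def)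
qed

lemma d_\<kappa>_lift: "d i (\<kappa>_lift j) p = pd (axis i 1) (\<lambda>x. \<kappa> x $ j) (fst p)"
  by (simp add: d_op_def dx_def dy_def pd_\<kappa>_lift)

text \<open>
  The contractions of $M$ with $l$ and with $m$ are obtained from the action of $[d_i, d_j]$ on $F$ and
  on $\theta$; the completeness of the frame assembles them.
\<close>

lemma M_tensor_eq:
  assumes "p \<in> W"
  shows "M n i j p = angular n p * curl \<kappa> i j (fst p)"
proof -
  have zero: "d i (d j F) p = 0" for i j
  proof -
    have "d i (d j F) p = d i (\<lambda>_. 0) p" by (rule d_cong[OF assms]) (rule d_F)
    then show ?thesis by (simp add: d_op_def dx_def dy_def has_pd_imp_pd[OF has_pd_const])
  qed
  have l: "M 1 i j p * l_low F 1 p + M 2 i j p * l_low F 2 p = 0"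
    using commutator_d[OF assms C_on_F, of i j] zero by (simp add: l_low_def)
  have "d i (d j \<theta>) p = pd (axis i 1) (\<lambda>x. \<kappa> x $ j) (fst p)" for i j
    unfolding d_\<kappa>_lift[symmetric] by (rule d_cong[OF assms d_\<theta>])
  then have "M 1 i j p * dy 1 \<theta> p + M 2 i j p * dy 2 \<theta> p = curl \<kappa> i j (fst p)"
    using commutator_d[OF assms C_on_le[OF C3_\<theta>], of i j] by (simp add: curl_def)
  then have m: "M 1 i j p * m_low F 1 p + M 2 i j p * m_low F 2 p = F p * curl \<kappa> i j (fst p)"
    using F_pos[OF assms] by (simp add: dy_\<theta>[OF assms] field_simps)
  have "M n i j p = (l_up F n p * l_low F 1 p + m_up F n p * m_low F 1 p) * M 1 i j p
      + (l_up F n p * l_low F 2 p + m_up F n p * m_low F 2 p) * M 2 i j p"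
    unfolding frame_complete[OF assms] using exhaust_2[of n] by auto
  also have "\<dots> = l_up F n p * (M 1 i j p * l_low F 1 p + M 2 i j p * l_low F 2 p)
      + m_up F n p * (M 1 i j p * m_low F 1 p + M 2 i j p * m_low F 2 p)"
    by (simp add: algebra_simps)
  finally show ?thesis unfolding l m by (simp add: angular_def)
qed

lemma D_fun: "D k n m = (\<lambda>p. - dy m (N k n) p)"
  by (simp add: fun_eq_iff D_coeff_def)

lemma d_D:
  assumes "p \<in> W"
  shows "d i (D n j k) p
    = - (dx i (dy k (N n j)) p + (N 1 i p * dy 1 (dy k (N n j)) p + N 2 i p * dy 2 (dy k (N n j)) p))"
proof -
  have "pd b (D n j k) p = - pd b (dy k (N n j)) p" for b
    unfolding D_fun
    by (intro has_pd_imp_pd has_pd_minus C1_has_pd[OF C1_dy_N] assms)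
  then show ?thesis by (simp add: d_op_def sum_2 dx_def dy_def algebra_simps)
qed

text \<open>
  In $\partial_k (d_i N^n_j)$ the derivative either passes through $d_i$, giving $-d_i D^n{}_{jk}$,
  or hits the coefficients of $d_i$, giving the product $D^m{}_{ik} D^n{}_{jm}$. Antisymmetrized in
  $i, j$ this is the negative of $E_k{}^n{}_{ij}$.
\<close>

lemma E_tensor_eq_dy_M:
  assumes "p \<in> W"
  shows "E_tensor F \<theta> \<kappa> k n i j p = - dy k (M n i j) p"
proof -
  let ?e = "(0, axis k 1) :: tpoint"
  have N: "has_pd ?e (N a b) (dy k (N a b) p) p" for a b
    unfolding dy_def by (rule has_pd_N[OF assms])
  have dN: "has_pd ?e (dx c (N a b)) (dx c (dy k (N a b)) p) p"
    "has_pd ?e (dy c (N a b)) (dy c (dy k (N a b)) p) p" for a b c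
    using fibre_derivative_commutes_on_N[OF assms horizontal_Basis, of k c a b]
      fibre_derivative_commutes_on_N[OF assms vertical_Basis, of k c a b]
    by (simp_all only: dx_def dy_def)
  have "has_pd ?e (d i (N n j)) (dx i (dy k (N n j)) p
     + ((dy k (N 1 i) p * dy 1 (N n j) p + N 1 i p * dy 1 (dy k (N n j)) p)
      + (dy k (N 2 i) p * dy 2 (N n j) p + N 2 i p * dy 2 (dy k (N n j)) p))) p" for i j
  proof -
    have d_eq: "d i (N n j) = (\<lambda>p. dx i (N n j) p + (N 1 i p * dy 1 (N n j) p + N 2 i p * dy 2 (N n j) p))"
      by (simp add: fun_eq_iff d_op_def sum_2)
    show ?thesis
      unfolding d_eq by (intro has_pd_add has_pd_mult N dN)
  qed
  from has_pd_diff[OF this[of i j] this[of j i]]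
  have "dy k (M n i j) p = (dx i (dy k (N n j)) p
     + ((dy k (N 1 i) p * dy 1 (N n j) p + N 1 i p * dy 1 (dy k (N n j)) p)
      + (dy k (N 2 i) p * dy 2 (N n j) p + N 2 i p * dy 2 (dy k (N n j)) p)))
     - (dx j (dy k (N n i)) p
     + ((dy k (N 1 j) p * dy 1 (N n i) p + N 1 j p * dy 1 (dy k (N n i)) p)
      + (dy k (N 2 j) p * dy 2 (N n i) p + N 2 j p * dy 2 (dy k (N n i)) p)))"
    unfolding M_tensor_def[abs_def] by (subst dy_def) (rule has_pd_imp_pd)
  then show ?thesis
    unfolding E_tensor_def sum_2 d_D[OF assms] D_coeff_def by (simp add: algebra_simps)
qed

lemma E_tensor_eq:
  assumes "p \<in> W"
  shows "E_tensor F \<theta> \<kappa> k n i j p = - dy k (angular n) p * curl \<kappa> i j (fst p)"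
proof -
  have "has_pd (0, axis k 1) (\<lambda>p. curl \<kappa> i j (fst p)) 0 p"
    by (simp add: has_pd_def)
  then have "dy k (M n i j) p = dy k (angular n) p * curl \<kappa> i j (fst p) + angular n p * 0"
    by (intro dy_eqI[OF assms M_tensor_eq[symmetric]] has_pd_mult has_pd_dy[OF _ assms]
        C_on_le[OF C2_angular]) simp_all
  then show ?thesis by (simp add: E_tensor_eq_dy_M[OF assms])
qed

end

theorem theorem3p1:
  fixes U :: "(real^2) set" and W :: "((real^2) \<times> (real^2)) set"
    and F \<theta> :: "(real^2) \<times> (real^2) \<Rightarrow> real" and \<kappa> :: "real^2 \<Rightarrow> real^2"
  assumes "conic_region U W"
    and "finsler_metric_on W F"
    and "angle_function_on W F \<theta>"
    and "covector_field_on U \<kappa>"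
  shows "\<forall>(x, y)\<in>W.
     (\<forall>n i j. M_tensor F \<theta> \<kappa> n i j (x, y) = F (x, y) * m_up F n (x, y) * curl \<kappa> i j x) \<and>
     (\<forall>k n i j. E_tensor F \<theta> \<kappa> k n i j (x, y) =
        (- l_low F k (x, y) * m_up F n (x, y) + l_up F n (x, y) * m_low F k (x, y)
         + main_scalar F (x, y) * m_low F k (x, y) * m_up F n (x, y)) * curl \<kappa> i j x)"
proof -
  interpret finsler_chart U W F \<theta> \<kappa>
    by unfold_locales (rule assms)+
  show ?thesis
  proof (clarify, intro conjI allI)
    fix x y and k n i j :: 2
    assume p: "(x, y) \<in> W"
    show "M_tensor F \<theta> \<kappa> n i j (x, y) = F (x, y) * m_up F n (x, y) * curl \<kappa> i j x"
      by (simp add: M_tensor_eq[OF p] angular_def)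
    have "- dy k (angular n) (x, y) = - l_low F k (x, y) * m_up F n (x, y) + l_up F n (x, y) * m_low F k (x, y)
         + main_scalar F (x, y) * m_low F k (x, y) * m_up F n (x, y)"
      by (simp add: dy_angular[OF p])
    then show "E_tensor F \<theta> \<kappa> k n i j (x, y) =
        (- l_low F k (x, y) * m_up F n (x, y) + l_up F n (x, y) * m_low F k (x, y)
         + main_scalar F (x, y) * m_low F k (x, y) * m_up F n (x, y)) * curl \<kappa> i j x"
      by (simp only: E_tensor_eq[OF p] fst_conv)
  qed
qed

end
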